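(* Let $\mathcal{A}$ be a quasi-abelian category, and let $$\begin{array}{ccccc} A_1 & \xrightarrow{\theta_1} & B_1 & \xrightarrow{\theta_2} & C_1\\ {\scriptstyle\alpha_1}\downarrow & S & {\scriptstyle\beta_1}\downarrow & T & \downarrow{\scriptstyle\gamma_1}\\ A_2 & \xrightarrow{\varphi_1} & B_2 & \xrightarrow{\varphi_2} & C_2\\ {\scriptstyle\alpha_2}\downarrow & U & {\scriptstyle\beta_2}\downarrow & V & \downarrow{\scriptstyle\gamma_2}\\ A_3 & \xrightarrow{\psi_1} & B_3 & \xrightarrow{\psi_2} & C_3\end{array}$$ be a commutative diagram in $\mathcal{A}$. Suppose that the first column is exact at $A_2$, the third column is exact at $C_2$, the second row is exact at $B_2$, $\operatorname{Im}T=0$, $\operatorname{Ker}U=0$, $\beta_2\beta_1=0$, and the morphisms $\varphi_1$ and $\varphi_2\beta_1$ are strict. Then the second column is exact at $B_2$.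
   Context: Composition is written right to left. For a morphism $\alpha$ in an additive category with kernels and cokernels, $\ker\alpha$, $\operatorname{coker}\alpha$ denote the kernel and cokernel morphisms and $\operatorname{Ker}\alpha$, $\operatorname{Coker}\alpha$ the corresponding objects; $\operatorname{im}\alpha=\ker\operatorname{coker}\alpha$ with source object $\operatorname{Im}\alpha$, $\operatorname{coim}\alpha=\operatorname{coker}\ker\alpha$ with target object $\operatorname{Coim}\alpha$; $\alpha=(\operatorname{im}\alpha)\bar\alpha(\operatorname{coim}\alpha)$ is the canonical decomposition. The morphism $\alpha$ is strict if $\bar\alpha$ is an isomorphism. A strict epimorphism is a morphism that is a cokernel; a strict monomorphism is a morphism that is a kernel. A quasi-abelian category is an additive category in which every morphism has a kernel and a cokernel, strict epimorphisms are stable under pullback, and strict monomorphisms are stable under pushout. A sequence $\cdot\xrightarrow{\alpha}\cdot\xrightarrow{\beta}\cdot$ is exact (at the middle term) if $\operatorname{im}\alpha=\ker\beta$ (as subobjects). Lambek invariants. For a commutative square $S$ with $\alpha:C\to D$, $g:C\to A$, $\beta:A\to B$, $f:D\to B$, $f\alpha=\beta g$ (letters here are local to this definition): (i) Let $I_S$ with $k_S:I_S\to\operatorname{Im}f$ and $l_S:I_S\to\operatorname{Im}\beta$ be the pullback of $\operatorname{im}f:\operatorname{Im}f\to B$ and $\operatorname{im}\beta:\operatorname{Im}\beta\to B$. There are morphisms $k':\operatorname{Im}(f\alpha)\to\operatorname{Im}f$ and $l':\operatorname{Im}(f\alpha)\to\operatorname{Im}\beta$ with $\operatorname{im}(f\alpha)=(\operatorname{im}f)k'=(\operatorname{im}\beta)l'$;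 let $\rho_S:\operatorname{Im}(f\alpha)\to I_S$ be the unique morphism with $k'=k_S\rho_S$, $l'=l_S\rho_S$. Put $\operatorname{Im}S=\operatorname{Coker}\rho_S$. (ii) Let $\mu_S:\operatorname{Ker}g\to\operatorname{Ker}(f\alpha)$ and $\nu_S:\operatorname{Ker}\alpha\to\operatorname{Ker}(f\alpha)$ be the natural inclusions, and $\langle\mu_S,\nu_S\rangle:\operatorname{Ker}g\oplus\operatorname{Ker}\alpha\to\operatorname{Ker}(f\alpha)$ the induced morphism. Put $\operatorname{Ker}S=\operatorname{Coker}\langle\mu_S,\nu_S\rangle$. In the diagram of the claim, $T$ is the upper right square (top $\theta_2$, left $\beta_1$, bottom $\varphi_2$, right $\gamma_1$), so $\operatorname{Im}T$ is the cokernel of the natural morphism from $\operatorname{Im}(\varphi_2\beta_1)=\operatorname{Im}(\gamma_1\theta_2)$ to the pullback of $\operatorname{im}\gamma_1$ and $\operatorname{im}\varphi_2$; and $U$ is the lower left square (top $\varphi_1$, left $\alpha_2$, bottom $\psi_1$, right $\beta_2$), so $\operatorname{Ker}U$ is the cokernel of the natural morphism $\operatorname{Ker}\alpha_2\oplus\operatorname{Ker}\varphi_1\to\operatorname{Ker}(\beta_2\varphi_1)$. *)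

theory Defs
  imports "HOL-Algebra.Group"
begin

section \<open>Categories\<close>

record ('o, 'm) category =
  Obj :: "'o set"
  Arr :: "'m set"
  Dom :: "'m \<Rightarrow> 'o"
  Cod :: "'m \<Rightarrow> 'o"
  Id :: "'o \<Rightarrow> 'm"
  Comp :: "'m \<Rightarrow> 'm \<Rightarrow> 'm" (infixr "\<cdot>\<index>" 75)

definition Hom :: "('o, 'm, 'x) category_scheme \<Rightarrow> 'o \<Rightarrow> 'o \<Rightarrow> 'm set"
  where "Hom C A B = {f \<in> Arr C. Dom C f = A \<and> Cod C f = B}"

locale category =
  fixes C :: "('o, 'm, 'x) category_scheme" (structure)
  assumes Dom_in_Obj: "f \<in> Arr C \<Longrightarrow> Dom C f \<in> Obj C"
    and Cod_in_Obj: "f \<in> Arr C \<Longrightarrow> Cod C f \<in> Obj C"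
    and Id_in_Hom: "A \<in> Obj C \<Longrightarrow> Id C A \<in> Hom C A A"
    and Comp_in_Hom: "f \<in> Hom C A B \<Longrightarrow> g \<in> Hom C B D \<Longrightarrow> g \<cdot> f \<in> Hom C A D"
    and Comp_Id: "f \<in> Hom C A B \<Longrightarrow> f \<cdot> Id C A = f"
    and Id_Comp: "f \<in> Hom C A B \<Longrightarrow> Id C B \<cdot> f = f"
    and Comp_assoc: "f \<in> Hom C A B \<Longrightarrow> g \<in> Hom C B D \<Longrightarrow> h \<in> Hom C D E
      \<Longrightarrow> (h \<cdot> g) \<cdot> f = h \<cdot> (g \<cdot> f)"

definition is_iso :: "('o, 'm, 'x) category_scheme \<Rightarrow> 'm \<Rightarrow> bool"
  where "is_iso C f \<longleftrightarrow> f \<in> Arr C \<and>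
    (\<exists>g \<in> Hom C (Cod C f) (Dom C f).
      g \<cdot>\<^bsub>C\<^esub> f = Id C (Dom C f) \<and> f \<cdot>\<^bsub>C\<^esub> g = Id C (Cod C f))"

definition is_zero_object :: "('o, 'm, 'x) category_scheme \<Rightarrow> 'o \<Rightarrow> bool"
  where "is_zero_object C Z \<longleftrightarrow> Z \<in> Obj C \<and>
    (\<forall>A \<in> Obj C. (\<exists>!f. f \<in> Hom C A Z) \<and> (\<exists>!f. f \<in> Hom C Z A))"

text \<open>
  The square \<open>f \<cdot> p = g \<cdot> q\<close> with \<open>p : P \<rightarrow> Dom f\<close> and \<open>q : P \<rightarrow> Dom g\<close> is a pullback; dually below,
  \<open>p \<cdot> f = q \<cdot> g\<close> with \<open>p : Cod f \<rightarrow> P\<close> and \<open>q : Cod g \<rightarrow> P\<close> is a pushout.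
\<close>

definition is_pullback :: "('o, 'm, 'x) category_scheme \<Rightarrow> 'm \<Rightarrow> 'm \<Rightarrow> 'm \<Rightarrow> 'm \<Rightarrow> bool"
  where "is_pullback C f g p q \<longleftrightarrow>
    f \<in> Arr C \<and> g \<in> Arr C \<and> Cod C f = Cod C g \<and>
    p \<in> Hom C (Dom C p) (Dom C f) \<and> q \<in> Hom C (Dom C p) (Dom C g) \<and>
    f \<cdot>\<^bsub>C\<^esub> p = g \<cdot>\<^bsub>C\<^esub> q \<and>
    (\<forall>X. \<forall>u \<in> Hom C X (Dom C f). \<forall>v \<in> Hom C X (Dom C g). f \<cdot>\<^bsub>C\<^esub> u = g \<cdot>\<^bsub>C\<^esub> v \<longrightarrow>
      (\<exists>!w. w \<in> Hom C X (Dom C p) \<and> p \<cdot>\<^bsub>C\<^esub> w = u \<and> q \<cdot>\<^bsub>C\<^esub> w = v))"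

definition is_pushout :: "('o, 'm, 'x) category_scheme \<Rightarrow> 'm \<Rightarrow> 'm \<Rightarrow> 'm \<Rightarrow> 'm \<Rightarrow> bool"
  where "is_pushout C f g p q \<longleftrightarrow>
    f \<in> Arr C \<and> g \<in> Arr C \<and> Dom C f = Dom C g \<and>
    p \<in> Hom C (Cod C f) (Cod C p) \<and> q \<in> Hom C (Cod C g) (Cod C p) \<and>
    p \<cdot>\<^bsub>C\<^esub> f = q \<cdot>\<^bsub>C\<^esub> g \<and>
    (\<forall>X. \<forall>u \<in> Hom C (Cod C f) X. \<forall>v \<in> Hom C (Cod C g) X. u \<cdot>\<^bsub>C\<^esub> f = v \<cdot>\<^bsub>C\<^esub> g \<longrightarrow>
      (\<exists>!w. w \<in> Hom C (Cod C p) X \<and> w \<cdot>\<^bsub>C\<^esub> p = u \<and> w \<cdot>\<^bsub>C\<^esub> q = v))"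


section \<open>Additive categories\<close>

record ('o, 'm) preadditive = "('o, 'm) category" +
  Add :: "'m \<Rightarrow> 'm \<Rightarrow> 'm"
  Zero :: "'o \<Rightarrow> 'o \<Rightarrow> 'm"

definition hom_group :: "('o, 'm, 'x) preadditive_scheme \<Rightarrow> 'o \<Rightarrow> 'o \<Rightarrow> 'm monoid"
  where "hom_group C A B = \<lparr>carrier = Hom C A B, mult = Add C, one = Zero C A B\<rparr>"

definition is_biproduct ::
  "('o, 'm, 'x) preadditive_scheme \<Rightarrow> 'o \<Rightarrow> 'o \<Rightarrow> 'm \<Rightarrow> 'm \<Rightarrow> 'm \<Rightarrow> 'm \<Rightarrow> bool"
  where "is_biproduct C A B i\<^sub>1 i\<^sub>2 p\<^sub>1 p\<^sub>2 \<longleftrightarrow>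
    (\<exists>P \<in> Obj C.
      i\<^sub>1 \<in> Hom C A P \<and> i\<^sub>2 \<in> Hom C B P \<and> p\<^sub>1 \<in> Hom C P A \<and> p\<^sub>2 \<in> Hom C P B \<and>
      p\<^sub>1 \<cdot>\<^bsub>C\<^esub> i\<^sub>1 = Id C A \<and> p\<^sub>2 \<cdot>\<^bsub>C\<^esub> i\<^sub>2 = Id C B \<and>
      p\<^sub>1 \<cdot>\<^bsub>C\<^esub> i\<^sub>2 = Zero C B A \<and> p\<^sub>2 \<cdot>\<^bsub>C\<^esub> i\<^sub>1 = Zero C A B \<and>
      Add C (i\<^sub>1 \<cdot>\<^bsub>C\<^esub> p\<^sub>1) (i\<^sub>2 \<cdot>\<^bsub>C\<^esub> p\<^sub>2) = Id C P)"

locale additive_category = category C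
  for C :: "('o, 'm, 'x) preadditive_scheme" (structure) +
  assumes hom_comm_group: "A \<in> Obj C \<Longrightarrow> B \<in> Obj C \<Longrightarrow> comm_group (hom_group C A B)"
    and Comp_Add: "f \<in> Hom C A B \<Longrightarrow> f' \<in> Hom C A B \<Longrightarrow> g \<in> Hom C B D
      \<Longrightarrow> g \<cdot> Add C f f' = Add C (g \<cdot> f) (g \<cdot> f')"
    and Add_Comp: "f \<in> Hom C A B \<Longrightarrow> g \<in> Hom C B D \<Longrightarrow> g' \<in> Hom C B D
      \<Longrightarrow> Add C g g' \<cdot> f = Add C (g \<cdot> f) (g' \<cdot> f)"
    and ex_zero_object: "\<exists>Z. is_zero_object C Z"
    and ex_biproduct: "A \<in> Obj C \<Longrightarrow> B \<in> Obj C
      \<Longrightarrow> \<exists>i\<^sub>1 i\<^sub>2 p\<^sub>1 p\<^sub>2. is_biproduct C A B i\<^sub>1 i\<^sub>2 p\<^sub>1 p\<^sub>2"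


section \<open>Kernels, cokernels and quasi-abelian categories\<close>

definition is_kernel :: "('o, 'm, 'x) preadditive_scheme \<Rightarrow> 'm \<Rightarrow> 'm \<Rightarrow> bool"
  where "is_kernel C f k \<longleftrightarrow>
    f \<in> Arr C \<and> k \<in> Hom C (Dom C k) (Dom C f) \<and>
    f \<cdot>\<^bsub>C\<^esub> k = Zero C (Dom C k) (Cod C f) \<and>
    (\<forall>X. \<forall>h \<in> Hom C X (Dom C f). f \<cdot>\<^bsub>C\<^esub> h = Zero C X (Cod C f) \<longrightarrow>
      (\<exists>!u. u \<in> Hom C X (Dom C k) \<and> k \<cdot>\<^bsub>C\<^esub> u = h))"

definition is_cokernel :: "('o, 'm, 'x) preadditive_scheme \<Rightarrow> 'm \<Rightarrow> 'm \<Rightarrow> bool"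
  where "is_cokernel C f c \<longleftrightarrow>
    f \<in> Arr C \<and> c \<in> Hom C (Cod C f) (Cod C c) \<and>
    c \<cdot>\<^bsub>C\<^esub> f = Zero C (Dom C f) (Cod C c) \<and>
    (\<forall>X. \<forall>h \<in> Hom C (Cod C f) X. h \<cdot>\<^bsub>C\<^esub> f = Zero C (Dom C f) X \<longrightarrow>
      (\<exists>!u. u \<in> Hom C (Cod C c) X \<and> u \<cdot>\<^bsub>C\<^esub> c = h))"

definition strict_mono_arr :: "('o, 'm, 'x) preadditive_scheme \<Rightarrow> 'm \<Rightarrow> bool"
  where "strict_mono_arr C m \<longleftrightarrow> (\<exists>f. is_kernel C f m)"

definition strict_epi_arr :: "('o, 'm, 'x) preadditive_scheme \<Rightarrow> 'm \<Rightarrow> bool"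
  where "strict_epi_arr C e \<longleftrightarrow> (\<exists>f. is_cokernel C f e)"

locale quasi_abelian_category = additive_category +
  assumes ex_kernel: "f \<in> Arr C \<Longrightarrow> \<exists>k. is_kernel C f k"
    and ex_cokernel: "f \<in> Arr C \<Longrightarrow> \<exists>c. is_cokernel C f c"
    and strict_epi_pullback: "is_pullback C f g p q \<Longrightarrow> strict_epi_arr C f \<Longrightarrow> strict_epi_arr C q"
    and strict_mono_pushout: "is_pushout C f g p q \<Longrightarrow> strict_mono_arr C f \<Longrightarrow> strict_mono_arr C q"

text \<open>
  Kernels, cokernels, pullbacks and biproducts are determined only up to a unique compatible
  isomorphism; the functions below fix an arbitrary choice of each.
\<close>

definition ker :: "('o, 'm, 'x) preadditive_scheme \<Rightarrow> 'm \<Rightarrow> 'm"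
  where "ker C f = (SOME k. is_kernel C f k)"

definition coker :: "('o, 'm, 'x) preadditive_scheme \<Rightarrow> 'm \<Rightarrow> 'm"
  where "coker C f = (SOME c. is_cokernel C f c)"

definition im :: "('o, 'm, 'x) preadditive_scheme \<Rightarrow> 'm \<Rightarrow> 'm"
  where "im C f = ker C (coker C f)"

definition coim :: "('o, 'm, 'x) preadditive_scheme \<Rightarrow> 'm \<Rightarrow> 'm"
  where "coim C f = coker C (ker C f)"

definition Ker_obj :: "('o, 'm, 'x) preadditive_scheme \<Rightarrow> 'm \<Rightarrow> 'o"
  where "Ker_obj C f = Dom C (ker C f)"

definition Coker_obj :: "('o, 'm, 'x) preadditive_scheme \<Rightarrow> 'm \<Rightarrow> 'o"
  where "Coker_obj C f = Cod C (coker C f)"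

definition Im_obj :: "('o, 'm, 'x) preadditive_scheme \<Rightarrow> 'm \<Rightarrow> 'o"
  where "Im_obj C f = Dom C (im C f)"

definition Coim_obj :: "('o, 'm, 'x) preadditive_scheme \<Rightarrow> 'm \<Rightarrow> 'o"
  where "Coim_obj C f = Cod C (coim C f)"

definition bar :: "('o, 'm, 'x) preadditive_scheme \<Rightarrow> 'm \<Rightarrow> 'm"
  where "bar C f =
    (THE b. b \<in> Hom C (Coim_obj C f) (Im_obj C f) \<and> f = im C f \<cdot>\<^bsub>C\<^esub> b \<cdot>\<^bsub>C\<^esub> coim C f)"

definition strict :: "('o, 'm, 'x) preadditive_scheme \<Rightarrow> 'm \<Rightarrow> bool"
  where "strict C f \<longleftrightarrow> is_iso C (bar C f)"

definition same_subobject :: "('o, 'm, 'x) category_scheme \<Rightarrow> 'm \<Rightarrow> 'm \<Rightarrow> bool"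
  where "same_subobject C m n \<longleftrightarrow> Cod C m = Cod C n \<and>
    (\<exists>u \<in> Hom C (Dom C m) (Dom C n). is_iso C u \<and> n \<cdot>\<^bsub>C\<^esub> u = m)"

definition exact :: "('o, 'm, 'x) preadditive_scheme \<Rightarrow> 'm \<Rightarrow> 'm \<Rightarrow> bool"
  where "exact C f g \<longleftrightarrow> same_subobject C (im C f) (ker C g)"


section \<open>Lambek invariants of a commutative square\<close>

text \<open>The factorization of \<open>h\<close> through the monomorphism \<open>m\<close>.\<close>

definition factor_through :: "('o, 'm, 'x) category_scheme \<Rightarrow> 'm \<Rightarrow> 'm \<Rightarrow> 'm"
  where "factor_through C m h = (THE u. u \<in> Hom C (Dom C h) (Dom C m) \<and> m \<cdot>\<^bsub>C\<^esub> u = h)"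

definition pullback_proj :: "('o, 'm, 'x) category_scheme \<Rightarrow> 'm \<Rightarrow> 'm \<Rightarrow> 'm \<times> 'm"
  where "pullback_proj C f g = (SOME (p, q). is_pullback C f g p q)"

definition biproduct_incl :: "('o, 'm, 'x) preadditive_scheme \<Rightarrow> 'o \<Rightarrow> 'o \<Rightarrow> 'm \<times> 'm"
  where "biproduct_incl C A B = (SOME (i\<^sub>1, i\<^sub>2). \<exists>p\<^sub>1 p\<^sub>2. is_biproduct C A B i\<^sub>1 i\<^sub>2 p\<^sub>1 p\<^sub>2)"

text \<open>The morphism \<open>\<langle>u, v\<rangle> : Dom u \<oplus> Dom v \<rightarrow> Cod u\<close>, for \<open>Cod u = Cod v\<close>.\<close>

definition copair :: "('o, 'm, 'x) preadditive_scheme \<Rightarrow> 'm \<Rightarrow> 'm \<Rightarrow> 'm"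
  where "copair C u v =
    (let (i\<^sub>1, i\<^sub>2) = biproduct_incl C (Dom C u) (Dom C v)
     in THE h. h \<in> Hom C (Cod C i\<^sub>1) (Cod C u) \<and> h \<cdot>\<^bsub>C\<^esub> i\<^sub>1 = u \<and> h \<cdot>\<^bsub>C\<^esub> i\<^sub>2 = v)"

text \<open>
  A square is given by its top \<open>\<alpha> : X \<rightarrow> D\<close>, left \<open>g : X \<rightarrow> A\<close>, bottom \<open>\<beta> : A \<rightarrow> B\<close> and right
  \<open>f : D \<rightarrow> B\<close> morphisms, in this order, with \<open>f \<cdot> \<alpha> = \<beta> \<cdot> g\<close>.
\<close>

definition square_rho :: "('o, 'm, 'x) preadditive_scheme \<Rightarrow> 'm \<Rightarrow> 'm \<Rightarrow> 'm \<Rightarrow> 'm \<Rightarrow> 'm"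
  where "square_rho C \<alpha> g \<beta> f =
    (let (k, l) = pullback_proj C (im C f) (im C \<beta>);
         k' = factor_through C (im C f) (im C (f \<cdot>\<^bsub>C\<^esub> \<alpha>));
         l' = factor_through C (im C \<beta>) (im C (f \<cdot>\<^bsub>C\<^esub> \<alpha>))
     in THE \<rho>. \<rho> \<in> Hom C (Im_obj C (f \<cdot>\<^bsub>C\<^esub> \<alpha>)) (Dom C k) \<and>
               k \<cdot>\<^bsub>C\<^esub> \<rho> = k' \<and> l \<cdot>\<^bsub>C\<^esub> \<rho> = l')"

definition square_Im :: "('o, 'm, 'x) preadditive_scheme \<Rightarrow> 'm \<Rightarrow> 'm \<Rightarrow> 'm \<Rightarrow> 'm \<Rightarrow> 'o"
  where "square_Im C \<alpha> g \<beta> f = Coker_obj C (square_rho C \<alpha> g \<beta> f)"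

definition square_Ker :: "('o, 'm, 'x) preadditive_scheme \<Rightarrow> 'm \<Rightarrow> 'm \<Rightarrow> 'm \<Rightarrow> 'm \<Rightarrow> 'o"
  where "square_Ker C \<alpha> g \<beta> f =
    (let \<mu> = factor_through C (ker C (f \<cdot>\<^bsub>C\<^esub> \<alpha>)) (ker C g);
         \<nu> = factor_through C (ker C (f \<cdot>\<^bsub>C\<^esub> \<alpha>)) (ker C \<alpha>)
     in Coker_obj C (copair C \<mu> \<nu>))"

end

theory Submission
  imports Defs
begin

text \<open>
  The proof is a chase of generalised elements, an element of an object being a morphism into it. A
  morphism \<open>x\<close> is regarded as lying in the image of \<open>f\<close> when \<open>coker f \<cdot> x = 0\<close>. Since
  \<open>\<beta>\<^sub>2 \<cdot> \<beta>\<^sub>1 = 0\<close>, exactness of the middle column means that \<open>c = coker \<beta>\<^sub>1\<close> kills \<open>x = ker \<beta>\<^sub>2\<close>.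

  The element \<open>\<phi>\<^sub>2 \<cdot> x\<close> is killed by \<open>\<gamma>\<^sub>2\<close>, so it lies in the images of both \<open>\<gamma>\<^sub>1\<close> and \<open>\<phi>\<^sub>2\<close>; because
  \<open>Im T = 0\<close>, it lies in the image of \<open>\<phi>\<^sub>2 \<cdot> \<beta>\<^sub>1\<close> (\<open>square_Im_zero\<close>). This last morphism is strict, so
  after composing with an epimorphism \<open>p\<close> the element lifts: \<open>\<phi>\<^sub>2 \<cdot> \<beta>\<^sub>1 \<cdot> y = \<phi>\<^sub>2 \<cdot> x \<cdot> p\<close>
  (\<open>strict_lift\<close>). Then \<open>d = x \<cdot> p - \<beta>\<^sub>1 \<cdot> y\<close> is killed by \<open>\<phi>\<^sub>2\<close>, hence lies in the image of the
  strict morphism \<open>\<phi>\<^sub>1\<close>, and after a further epimorphism \<open>q\<close> it equals \<open>\<phi>\<^sub>1 \<cdot> z\<close>. As \<open>\<beta>\<^sub>2 \<cdot> d = 0\<close>, the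
  element \<open>z\<close> lies in \<open>Ker (\<beta>\<^sub>2 \<cdot> \<phi>\<^sub>1)\<close>, which, as \<open>Ker U = 0\<close>, receives an epimorphism from
  \<open>Ker \<alpha>\<^sub>2 \<oplus> Ker \<phi>\<^sub>1\<close> (\<open>square_Ker_zero\<close>). The morphism \<open>c \<cdot> \<phi>\<^sub>1\<close> kills \<open>Ker \<phi>\<^sub>1\<close> trivially, and kills \<open>Ker \<alpha>\<^sub>2\<close> because that
  is the image of \<open>\<alpha>\<^sub>1\<close> and \<open>c \<cdot> \<phi>\<^sub>1 \<cdot> \<alpha>\<^sub>1 = c \<cdot> \<beta>\<^sub>1 \<cdot> \<theta>\<^sub>1 = 0\<close>. Thus \<open>c \<cdot> x \<cdot> p \<cdot> q = c \<cdot> \<phi>\<^sub>1 \<cdot> z = 0\<close>,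
  and cancelling the two epimorphisms gives \<open>c \<cdot> x = 0\<close>.

  Beyond kernels and cokernels, quasi-abelianness enters through \<open>strict_lift\<close>: the refining epimorphisms are pullbacks of strict
  epimorphisms, and it is their stability under pullback that keeps them epic.
\<close>

section \<open>Calculating with morphisms in an additive category\<close>

lemma Hom_arr:
  assumes "f \<in> Hom C A B"
  shows "f \<in> Arr C" "Dom C f = A" "Cod C f = B"
  using assms by (auto simp: Hom_def)

lemma (in category) Hom_obj:
  assumes "f \<in> Hom C A B"
  shows "A \<in> Obj C" "B \<in> Obj C"
  using assms Dom_in_Obj Cod_in_Obj by (auto simp: Hom_def)

context additive_category
begin

lemma Zero_in_Hom:
  assumes "A \<in> Obj C" "B \<in> Obj C"
  shows "Zero C A B \<in> Hom C A B"
proof -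
  interpret G: comm_group "hom_group C A B" by (rule hom_comm_group[OF assms])
  show ?thesis using G.one_closed by (simp add: hom_group_def)
qed

lemma Add_in_Hom:
  assumes "f \<in> Hom C A B" "g \<in> Hom C A B"
  shows "Add C f g \<in> Hom C A B"
proof -
  interpret G: comm_group "hom_group C A B"
    by (rule hom_comm_group[OF Hom_obj[OF assms(1)]])
  show ?thesis using G.m_closed assms by (simp add: hom_group_def)
qed

lemma Add_Zero:
  assumes "f \<in> Hom C A B"
  shows "Add C f (Zero C A B) = f" "Add C (Zero C A B) f = f"
proof -
  interpret G: comm_group "hom_group C A B"
    by (rule hom_comm_group[OF Hom_obj[OF assms]])
  show "Add C f (Zero C A B) = f" "Add C (Zero C A B) f = f"
    using G.r_one[of f] G.l_one[of f] assms by (simp_all add: hom_group_def)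
qed

lemma obtain_negative:
  assumes "f \<in> Hom C A B"
  obtains f' where "f' \<in> Hom C A B" "Add C f f' = Zero C A B"
proof -
  interpret G: comm_group "hom_group C A B"
    by (rule hom_comm_group[OF Hom_obj[OF assms]])
  show ?thesis
    using G.inv_closed[of f] G.r_inv[of f] assms that by (simp add: hom_group_def)
qed

lemma Add_right_cancel:
  assumes "f \<in> Hom C A B" "g \<in> Hom C A B" "h \<in> Hom C A B" "Add C f h = Add C g h"
  shows "f = g"
proof -
  interpret G: comm_group "hom_group C A B"
    by (rule hom_comm_group[OF Hom_obj[OF assms(1)]])
  show ?thesis using G.right_cancel[of h f g] assms by (simp add: hom_group_def)
qed

lemma Comp_Zero:
  assumes "g \<in> Hom C B D" "A \<in> Obj C"
  shows "g \<cdot> Zero C A B = Zero C A D"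
proof -
  note z = Zero_in_Hom[OF assms(2) Hom_obj(1)[OF assms(1)]]
  note zD = Zero_in_Hom[OF assms(2) Hom_obj(2)[OF assms(1)]]
  note gz = Comp_in_Hom[OF z assms(1)]
  have "Add C (g \<cdot> Zero C A B) (g \<cdot> Zero C A B) = g \<cdot> Zero C A B"
    using Comp_Add[OF z z assms(1)] Add_Zero[OF z] by simp
  then show ?thesis
    using Add_right_cancel[OF gz zD gz] Add_Zero[OF gz] by simp
qed

lemma Zero_Comp:
  assumes "f \<in> Hom C A B" "D \<in> Obj C"
  shows "Zero C B D \<cdot> f = Zero C A D"
proof -
  note z = Zero_in_Hom[OF Hom_obj(2)[OF assms(1)] assms(2)]
  note zA = Zero_in_Hom[OF Hom_obj(1)[OF assms(1)] assms(2)]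
  note zf = Comp_in_Hom[OF assms(1) z]
  have "Add C (Zero C B D \<cdot> f) (Zero C B D \<cdot> f) = Zero C B D \<cdot> f"
    using Add_Comp[OF assms(1) z z] Add_Zero[OF z] by simp
  then show ?thesis
    using Add_right_cancel[OF zf zA zf] Add_Zero[OF zf] by simp
qed

lemma Comp_eq_Zero_left:
  assumes "f \<in> Hom C A B" "g \<in> Hom C B D" "h \<in> Hom C D E" "h \<cdot> g = Zero C B E"
  shows "h \<cdot> (g \<cdot> f) = Zero C A E"
  using Comp_assoc[OF assms(1-3)] Zero_Comp[OF assms(1) Hom_obj(2)[OF assms(3)]] assms(4)
  by simp

lemma Comp_eq_Zero_right:
  assumes "f \<in> Hom C A B" "g \<in> Hom C B D" "h \<in> Hom C D E" "g \<cdot> f = Zero C A D"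
  shows "(h \<cdot> g) \<cdot> f = Zero C A E"
  using Comp_assoc[OF assms(1-3)] Comp_Zero[OF assms(3) Hom_obj(1)[OF assms(1)]] assms(4)
  by simp

text \<open>
  Being epic, in the form that compares only with zero; the two agree because the hom-sets are
  groups (\<open>epi_eq\<close>).
\<close>

definition epi :: "'m \<Rightarrow> bool"
  where "epi p \<longleftrightarrow> p \<in> Arr C \<and>
    (\<forall>Y. \<forall>h \<in> Hom C (Cod C p) Y. h \<cdot> p = Zero C (Dom C p) Y \<longrightarrow> h = Zero C (Cod C p) Y)"

lemma epiD:
  assumes "epi p" "p \<in> Hom C A B" "h \<in> Hom C B Y" "h \<cdot> p = Zero C A Y"
  shows "h = Zero C B Y"
  using assms unfolding epi_def by (auto simp: Hom_def)

lemma epi_cokernel: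
  assumes "is_cokernel C f c"
  shows "epi c"
  unfolding epi_def
proof (intro conjI allI ballI impI)
  have c: "c \<in> Hom C (Cod C f) (Cod C c)" and f: "f \<in> Hom C (Dom C f) (Cod C f)"
    using assms by (auto simp: is_cokernel_def Hom_def)
  show "c \<in> Arr C" using c by (simp add: Hom_def)
  fix Y h assume h: "h \<in> Hom C (Cod C c) Y" and hc: "h \<cdot> c = Zero C (Dom C c) Y"
  have Y: "Y \<in> Obj C" using Hom_obj[OF h] by simp
  have D: "Dom C c = Cod C f" using c by (simp add: Hom_def)
  let ?z = "Zero C (Cod C c) Y"
  have z: "?z \<in> Hom C (Cod C c) Y" using Zero_in_Hom Hom_obj[OF h] by simp
  have zc: "?z \<cdot> c = Zero C (Cod C f) Y" by (rule Zero_Comp[OF c Y])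
  have "Zero C (Cod C f) Y \<cdot> f = Zero C (Dom C f) Y" by (rule Zero_Comp[OF f Y])
  moreover have "Zero C (Cod C f) Y \<in> Hom C (Cod C f) Y"
    using Zero_in_Hom Hom_obj[OF c] Y by simp
  ultimately have "\<exists>!u. u \<in> Hom C (Cod C c) Y \<and> u \<cdot> c = Zero C (Cod C f) Y"
    using assms unfolding is_cokernel_def by blast
  then show "h = ?z" using h hc z zc D by metis
qed

lemma kernelD:
  assumes "is_kernel C f k" "f \<in> Hom C A B"
  shows "k \<in> Hom C (Dom C k) A" "f \<cdot> k = Zero C (Dom C k) B"
  using assms by (auto simp: is_kernel_def Hom_def)

lemma kernel_factor:
  assumes "is_kernel C f k" "f \<in> Hom C A B" "h \<in> Hom C X A" "f \<cdot> h = Zero C X B"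
  obtains u where "u \<in> Hom C X (Dom C k)" "k \<cdot> u = h"
  using assms(1,3,4) that unfolding is_kernel_def Hom_arr[OF assms(2)] by blast

lemma kernel_mono:
  assumes "is_kernel C f k" "u \<in> Hom C X (Dom C k)" "v \<in> Hom C X (Dom C k)" "k \<cdot> u = k \<cdot> v"
  shows "u = v"
proof -
  have f: "f \<in> Hom C (Dom C f) (Cod C f)" using assms(1) by (simp add: is_kernel_def Hom_def)
  note k = kernelD[OF assms(1) f]
  have "f \<cdot> (k \<cdot> v) = Zero C X (Cod C f)" by (rule Comp_eq_Zero_left[OF assms(3) k(1) f k(2)])
  then have "\<exists>!u. u \<in> Hom C X (Dom C k) \<and> k \<cdot> u = k \<cdot> v"
    using assms(1) Comp_in_Hom[OF assms(3) k(1)] unfolding is_kernel_def by blast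
  then show ?thesis using assms by blast
qed

lemma cokernelD:
  assumes "is_cokernel C f c" "f \<in> Hom C A B"
  shows "c \<in> Hom C B (Cod C c)" "c \<cdot> f = Zero C A (Cod C c)"
  using assms by (auto simp: is_cokernel_def Hom_def)

lemma cokernel_factor:
  assumes "is_cokernel C f c" "f \<in> Hom C A B" "h \<in> Hom C B X" "h \<cdot> f = Zero C A X"
  obtains u where "u \<in> Hom C (Cod C c) X" "u \<cdot> c = h"
  using assms(1,3,4) that unfolding is_cokernel_def Hom_arr[OF assms(2)] by blast

lemma epi_eq:
  assumes "epi p" "p \<in> Hom C A B" "h \<in> Hom C B Y" "k \<in> Hom C B Y" "h \<cdot> p = k \<cdot> p"
  shows "h = k"
proof -
  obtain k' where k': "k' \<in> Hom C B Y" "Add C k k' = Zero C B Y"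
    using obtain_negative[OF assms(4)] .
  have "Add C h k' \<cdot> p = Add C k k' \<cdot> p"
    using Add_Comp[OF assms(2,3) k'(1)] Add_Comp[OF assms(2,4) k'(1)] assms(5) by simp
  also have "\<dots> = Zero C A Y" using k'(2) Zero_Comp[OF assms(2) Hom_obj(2)[OF assms(3)]] by simp
  finally have "Add C h k' = Zero C B Y" by (rule epiD[OF assms(1,2) Add_in_Hom[OF assms(3) k'(1)]])
  then show ?thesis using Add_right_cancel[OF assms(3,4) k'(1)] k'(2) by simp
qed

lemma epi_if_zero_cokernel:
  assumes "is_cokernel C f c" "is_zero_object C (Cod C c)"
  shows "epi f"
  unfolding epi_def
proof (intro conjI allI ballI impI)
  have f: "f \<in> Hom C (Dom C f) (Cod C f)" using assms by (auto simp: is_cokernel_def Hom_def)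
  then show "f \<in> Arr C" by (simp add: Hom_def)
  fix Y h assume h: "h \<in> Hom C (Cod C f) Y" and hf: "h \<cdot> f = Zero C (Dom C f) Y"
  obtain u where u: "u \<in> Hom C (Cod C c) Y" "u \<cdot> c = h"
    using cokernel_factor[OF assms(1) f h hf] .
  have "u = Zero C (Cod C c) Y"
    using assms(2) u(1) Zero_in_Hom[OF Hom_obj[OF u(1)]] Hom_obj[OF u(1)]
    unfolding is_zero_object_def by blast
  then show "h = Zero C (Cod C f) Y"
    using u(2) Zero_Comp[OF cokernelD(1)[OF assms(1) f] Hom_obj(2)[OF u(1)]] by simp
qed

lemma is_biproductE:
  assumes "is_biproduct C A B i j p q"
  obtains P where "i \<in> Hom C A P" "j \<in> Hom C B P" "p \<in> Hom C P A" "q \<in> Hom C P B"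
    "p \<cdot> i = Id C A" "q \<cdot> j = Id C B" "p \<cdot> j = Zero C B A" "q \<cdot> i = Zero C A B"
    "Add C (i \<cdot> p) (j \<cdot> q) = Id C P"
  using assms unfolding is_biproduct_def by blast

lemma biproduct_copair:
  assumes "is_biproduct C A B i j p q" "u \<in> Hom C A X" "v \<in> Hom C B X"
  shows "\<exists>!h. h \<in> Hom C (Cod C i) X \<and> h \<cdot> i = u \<and> h \<cdot> j = v"
proof -
  obtain P where b: "i \<in> Hom C A P" "j \<in> Hom C B P" "p \<in> Hom C P A" "q \<in> Hom C P B"
    "p \<cdot> i = Id C A" "q \<cdot> j = Id C B" "p \<cdot> j = Zero C B A" "q \<cdot> i = Zero C A B"
    "Add C (i \<cdot> p) (j \<cdot> q) = Id C P"
    using is_biproductE[OF assms(1)] .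
  have P: "Cod C i = P" using b(1) by (simp add: Hom_def)
  note up = Comp_in_Hom[OF b(3) assms(2)] and vq = Comp_in_Hom[OF b(4) assms(3)]
  let ?h = "Add C (u \<cdot> p) (v \<cdot> q)"
  show ?thesis unfolding P
  proof (rule ex1I[of _ ?h], intro conjI)
    show "?h \<in> Hom C P X" by (rule Add_in_Hom[OF up vq])
    show "?h \<cdot> i = u"
      using Add_Comp[OF b(1) up vq] Comp_assoc[OF b(1,3) assms(2)] Comp_assoc[OF b(1,4) assms(3)]
        Comp_Id[OF assms(2)] Comp_Zero[OF assms(3) Hom_obj(1)[OF b(1)]] Add_Zero[OF assms(2)] b(5,8)
      by simp
    show "?h \<cdot> j = v"
      using Add_Comp[OF b(2) up vq] Comp_assoc[OF b(2,3) assms(2)] Comp_assoc[OF b(2,4) assms(3)]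
        Comp_Id[OF assms(3)] Comp_Zero[OF assms(2) Hom_obj(1)[OF b(2)]] Add_Zero[OF assms(3)] b(6,7)
      by simp
    fix h assume h: "h \<in> Hom C P X \<and> h \<cdot> i = u \<and> h \<cdot> j = v"
    then have hP: "h \<in> Hom C P X" by simp
    have "h = h \<cdot> Add C (i \<cdot> p) (j \<cdot> q)" using Comp_Id[OF hP] b(9) by simp
    also have "\<dots> = ?h"
      using Comp_Add[OF Comp_in_Hom[OF b(3,1)] Comp_in_Hom[OF b(4,2)] hP]
        Comp_assoc[OF b(3,1) hP] Comp_assoc[OF b(4,2) hP] h by simp
    finally show "h = ?h" .
  qed
qed

lemma copair:
  assumes "u \<in> Hom C A X" "v \<in> Hom C B X"
  obtains i j P where "i \<in> Hom C A P" "j \<in> Hom C B P" "copair C u v \<in> Hom C P X"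
    "copair C u v \<cdot> i = u" "copair C u v \<cdot> j = v"
    "\<And>Y h. h \<in> Hom C P Y \<Longrightarrow> h \<cdot> i = Zero C A Y \<Longrightarrow> h \<cdot> j = Zero C B Y \<Longrightarrow> h = Zero C P Y"
proof -
  obtain i j where ij: "biproduct_incl C A B = (i, j)" by fastforce
  have "\<exists>x. case x of (i, j) \<Rightarrow> \<exists>p q. is_biproduct C A B i j p q"
    using ex_biproduct[OF Hom_obj(1)[OF assms(1)] Hom_obj(1)[OF assms(2)]] by auto
  from someI_ex[OF this] have "\<exists>p q. is_biproduct C A B i j p q"
    using ij by (simp add: biproduct_incl_def)
  then obtain p q where b: "is_biproduct C A B i j p q" by blast
  obtain P where P: "i \<in> Hom C A P" "j \<in> Hom C B P" using is_biproductE[OF b] by metis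
  have cP: "Cod C i = P" using P(1) by (simp add: Hom_def)
  have eq: "copair C u v = (THE h. h \<in> Hom C (Cod C i) X \<and> h \<cdot> i = u \<and> h \<cdot> j = v)"
    using assms ij by (simp add: copair_def Hom_arr)
  have c: "copair C u v \<in> Hom C P X \<and> copair C u v \<cdot> i = u \<and> copair C u v \<cdot> j = v"
    unfolding eq using theI'[OF biproduct_copair[OF b assms]] cP by simp
  have "h = Zero C P Y"
    if h: "h \<in> Hom C P Y" "h \<cdot> i = Zero C A Y" "h \<cdot> j = Zero C B Y" for Y h
  proof -
    have Y: "Y \<in> Obj C" using Hom_obj[OF h(1)] by simp
    have "\<exists>!h. h \<in> Hom C P Y \<and> h \<cdot> i = Zero C A Y \<and> h \<cdot> j = Zero C B Y"
      using biproduct_copair[OF b Zero_in_Hom Zero_in_Hom] Hom_obj[OF P(1)] Hom_obj[OF P(2)] Y cP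
      by simp
    moreover have "Zero C P Y \<in> Hom C P Y" "Zero C P Y \<cdot> i = Zero C A Y" "Zero C P Y \<cdot> j = Zero C B Y"
      using Zero_in_Hom Zero_Comp P Y Hom_obj[OF P(1)] by auto
    ultimately show ?thesis using h by blast
  qed
  then show ?thesis using that P c by blast
qed

end


section \<open>Images, exactness and pullbacks\<close>

context quasi_abelian_category
begin

lemma is_kernel_ker: "f \<in> Hom C A B \<Longrightarrow> is_kernel C f (ker C f)"
  unfolding ker_def by (rule someI_ex[OF ex_kernel[OF Hom_arr(1)]])

lemma is_cokernel_coker: "f \<in> Hom C A B \<Longrightarrow> is_cokernel C f (coker C f)"
  unfolding coker_def by (rule someI_ex[OF ex_cokernel[OF Hom_arr(1)]])

lemma ker_Hom:
  assumes "f \<in> Hom C A B"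
  shows "ker C f \<in> Hom C (Ker_obj C f) A" "f \<cdot> ker C f = Zero C (Ker_obj C f) B"
  using kernelD[OF is_kernel_ker[OF assms] assms] by (simp_all add: Ker_obj_def)

lemma coker_Hom:
  assumes "f \<in> Hom C A B"
  shows "coker C f \<in> Hom C B (Coker_obj C f)" "coker C f \<cdot> f = Zero C A (Coker_obj C f)"
  using cokernelD[OF is_cokernel_coker[OF assms] assms] by (simp_all add: Coker_obj_def)

lemma is_kernel_im: "f \<in> Hom C A B \<Longrightarrow> is_kernel C (coker C f) (im C f)"
  unfolding im_def by (rule is_kernel_ker[OF coker_Hom(1)])

lemma im_Hom:
  assumes "f \<in> Hom C A B"
  shows "im C f \<in> Hom C (Im_obj C f) B"
    "coker C f \<cdot> im C f = Zero C (Im_obj C f) (Coker_obj C f)"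
  using kernelD[OF is_kernel_im[OF assms] coker_Hom(1)[OF assms]] by (simp_all add: Im_obj_def)

lemma im_factor:
  assumes "f \<in> Hom C A B" "x \<in> Hom C X B" "coker C f \<cdot> x = Zero C X (Coker_obj C f)"
  obtains u where "u \<in> Hom C X (Im_obj C f)" "im C f \<cdot> u = x"
  using kernel_factor[OF is_kernel_im[OF assms(1)] coker_Hom(1)[OF assms(1)] assms(2,3)]
  by (auto simp: Im_obj_def)

lemma factor_through_eq:
  assumes "is_kernel C f k" "k \<in> Hom C K A" "u \<in> Hom C X K" "k \<cdot> u = h"
  shows "factor_through C k h = u"
proof -
  have "Dom C k = K" using assms(2) by (simp add: Hom_def)
  moreover have "Dom C h = X" using Comp_in_Hom[OF assms(3,2)] assms(4) by (simp add: Hom_def)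
  ultimately show ?thesis unfolding factor_through_def
    using assms kernel_mono[OF assms(1)] by (intro the_equality) auto
qed

text \<open>
  Subobjects are compared through the composite \<open>coker f \<cdot> x\<close>: its vanishing expresses that \<open>x\<close>
  lies in the image of \<open>f\<close>, because \<open>im f\<close> is the kernel of \<open>coker f\<close>. Exactness thus turns
  \<open>g \<cdot> x = 0\<close> into \<open>coker f \<cdot> x = 0\<close>, and \<open>exactI\<close> is the way back.
\<close>

lemma exact_coker_Comp:
  assumes "exact C f g" "f \<in> Hom C A B" "g \<in> Hom C B D" "x \<in> Hom C X B" "g \<cdot> x = Zero C X D"
  shows "coker C f \<cdot> x = Zero C X (Coker_obj C f)"
proof -
  obtain u where u: "u \<in> Hom C (Im_obj C f) (Ker_obj C g)" "is_iso C u" "ker C g \<cdot> u = im C f"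
    using assms(1) unfolding exact_def same_subobject_def Im_obj_def Ker_obj_def by blast
  note k = ker_Hom[OF assms(3)] and c = coker_Hom[OF assms(2)] and m = im_Hom[OF assms(2)]
  obtain v where v: "v \<in> Hom C (Ker_obj C g) (Im_obj C f)" "u \<cdot> v = Id C (Ker_obj C g)"
    using u(1,2) unfolding is_iso_def by (auto simp: Hom_def)
  have "im C f \<cdot> v = ker C g"
    using Comp_assoc[OF v(1) u(1) k(1)] u(3) v(2) Comp_Id[OF k(1)] by simp
  then have ck: "coker C f \<cdot> ker C g = Zero C (Ker_obj C g) (Coker_obj C f)"
    using Comp_eq_Zero_left[OF v(1) m(1) c(1) m(2)] by simp
  obtain w where w: "w \<in> Hom C X (Ker_obj C g)" "ker C g \<cdot> w = x"
    using kernel_factor[OF is_kernel_ker[OF assms(3)] assms(3-5)] by (auto simp: Ker_obj_def)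
  show ?thesis using Comp_eq_Zero_left[OF w(1) k(1) c(1) ck] w(2) by simp
qed

lemma exactI:
  assumes "f \<in> Hom C A B" "g \<in> Hom C B D" "g \<cdot> f = Zero C A D"
    and "coker C f \<cdot> ker C g = Zero C (Ker_obj C g) (Coker_obj C f)"
  shows "exact C f g"
proof -
  note k = ker_Hom[OF assms(2)] and c = coker_Hom[OF assms(1)] and m = im_Hom[OF assms(1)]
  obtain v where v: "v \<in> Hom C (Ker_obj C g) (Im_obj C f)" "im C f \<cdot> v = ker C g"
    using im_factor[OF assms(1) k(1) assms(4)] .
  obtain g' where g': "g' \<in> Hom C (Coker_obj C f) D" "g' \<cdot> coker C f = g"
    using cokernel_factor[OF is_cokernel_coker[OF assms(1)] assms(1-3)]
    by (auto simp: Coker_obj_def)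
  have "g \<cdot> im C f = Zero C (Im_obj C f) D"
    using Comp_eq_Zero_right[OF m(1) c(1) g'(1) m(2)] g'(2) by simp
  then obtain u where u: "u \<in> Hom C (Im_obj C f) (Ker_obj C g)" "ker C g \<cdot> u = im C f"
    using kernel_factor[OF is_kernel_ker[OF assms(2)] assms(2) m(1)] by (auto simp: Ker_obj_def)
  note vu = Comp_in_Hom[OF u(1) v(1)] and uv = Comp_in_Hom[OF v(1) u(1)]
  note idI = Id_in_Hom[OF Hom_obj(1)[OF m(1)]] and idK = Id_in_Hom[OF Hom_obj(1)[OF k(1)]]
  have "v \<cdot> u = Id C (Im_obj C f)"
    using kernel_mono[OF is_kernel_im[OF assms(1)], folded Im_obj_def, OF vu idI]
      Comp_assoc[OF u(1) v(1) m(1)] u(2) v(2) Comp_Id[OF m(1)] by simp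
  moreover have "u \<cdot> v = Id C (Ker_obj C g)"
    using kernel_mono[OF is_kernel_ker[OF assms(2)], folded Ker_obj_def, OF uv idK]
      Comp_assoc[OF v(1) u(1) k(1)] u(2) v(2) Comp_Id[OF k(1)] by simp
  ultimately have "is_iso C u" using u(1) v(1) unfolding is_iso_def by (auto simp: Hom_def)
  then show ?thesis
    using u Hom_arr(3)[OF m(1)] Hom_arr(3)[OF k(1)]
    unfolding exact_def same_subobject_def Im_obj_def Ker_obj_def by auto
qed

text \<open>The pullback of \<open>f\<close> and \<open>g\<close> is the kernel of \<open>f \<cdot> p\<^sub>1 - g \<cdot> p\<^sub>2\<close> on the biproduct.\<close>

lemma ex_pullback:
  assumes "f \<in> Hom C A D" "g \<in> Hom C B D"
  obtains p q where "is_pullback C f g p q"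
proof -
  obtain i j p q where "is_biproduct C A B i j p q"
    using ex_biproduct[OF Hom_obj(1)[OF assms(1)] Hom_obj(1)[OF assms(2)]] by blast
  then obtain P where b: "i \<in> Hom C A P" "j \<in> Hom C B P" "p \<in> Hom C P A" "q \<in> Hom C P B"
    "p \<cdot> i = Id C A" "q \<cdot> j = Id C B" "p \<cdot> j = Zero C B A" "q \<cdot> i = Zero C A B"
    "Add C (i \<cdot> p) (j \<cdot> q) = Id C P"
    by (rule is_biproductE)
  obtain g' where g': "g' \<in> Hom C B D" "Add C g g' = Zero C B D"
    using obtain_negative[OF assms(2)] .
  define h where "h = Add C (f \<cdot> p) (g' \<cdot> q)"
  note fp = Comp_in_Hom[OF b(3) assms(1)] and gq = Comp_in_Hom[OF b(4) g'(1)]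
  have h: "h \<in> Hom C P D" unfolding h_def by (rule Add_in_Hom[OF fp gq])
  define k where "k = ker C h"
  define K where "K = Ker_obj C h"
  have k: "k \<in> Hom C K P" "h \<cdot> k = Zero C K D" and kk: "is_kernel C h k" and dk: "Dom C k = K"
    using ker_Hom[OF h] is_kernel_ker[OF h] by (auto simp: k_def K_def Ker_obj_def)
  note pk = Comp_in_Hom[OF k(1) b(3)] and qk = Comp_in_Hom[OF k(1) b(4)]
  \<comment> \<open>\<open>h\<close> is the difference of the two composites; this serves both the cone itself
      (\<open>x = k\<close>) and the factorization of a competing cone (\<open>x = w0\<close>).\<close>
  have hx: "h \<cdot> x = Zero C X D \<longleftrightarrow> f \<cdot> (p \<cdot> x) = g \<cdot> (q \<cdot> x)" if x: "x \<in> Hom C X P" for X x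
  proof -
    note px = Comp_in_Hom[OF x b(3)] and qx = Comp_in_Hom[OF x b(4)]
    have 1: "h \<cdot> x = Add C (f \<cdot> (p \<cdot> x)) (g' \<cdot> (q \<cdot> x))"
      unfolding h_def using Add_Comp[OF x fp gq] Comp_assoc[OF x b(3) assms(1)]
        Comp_assoc[OF x b(4) g'(1)] by simp
    have 2: "Add C (g \<cdot> (q \<cdot> x)) (g' \<cdot> (q \<cdot> x)) = Zero C X D"
      using Add_Comp[OF qx assms(2) g'(1)] g'(2) Zero_Comp[OF qx Hom_obj(2)[OF assms(1)]] by simp
    show ?thesis
      using 1 2 Add_right_cancel[OF Comp_in_Hom[OF px assms(1)] Comp_in_Hom[OF qx assms(2)]
          Comp_in_Hom[OF qx g'(1)]] by metis
  qed
  have "is_pullback C f g (p \<cdot> k) (q \<cdot> k)"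
    unfolding is_pullback_def Hom_arr[OF assms(1)] Hom_arr[OF assms(2)] Hom_arr(2)[OF pk]
  proof (intro conjI allI ballI impI)
    show "f \<in> Arr C" "g \<in> Arr C" using assms by (auto simp: Hom_def)
    show "p \<cdot> k \<in> Hom C K A" "q \<cdot> k \<in> Hom C K B" by (fact pk qk)+
    show "f \<cdot> (p \<cdot> k) = g \<cdot> (q \<cdot> k)" using hx[OF k(1)] k(2) by simp
    fix X u v assume u: "u \<in> Hom C X A" and v: "v \<in> Hom C X B" and fu: "f \<cdot> u = g \<cdot> v"
    note iu = Comp_in_Hom[OF u b(1)] and jv = Comp_in_Hom[OF v b(2)]
    define w0 where "w0 = Add C (i \<cdot> u) (j \<cdot> v)"
    have w0: "w0 \<in> Hom C X P" unfolding w0_def by (rule Add_in_Hom[OF iu jv])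
    have X: "X \<in> Obj C" using Hom_obj[OF u] by simp
    have pw0: "p \<cdot> w0 = u"
      unfolding w0_def using Comp_Add[OF iu jv b(3)] Comp_assoc[OF u b(1,3)] Comp_assoc[OF v b(2,3)]
        b(5,7) Id_Comp[OF u] Zero_Comp[OF v Hom_obj(2)[OF u]] Add_Zero[OF u] by simp
    have qw0: "q \<cdot> w0 = v"
      unfolding w0_def using Comp_Add[OF iu jv b(4)] Comp_assoc[OF u b(1,4)] Comp_assoc[OF v b(2,4)]
        b(6,8) Id_Comp[OF v] Zero_Comp[OF u Hom_obj(2)[OF v]] Add_Zero[OF v] by simp
    have "h \<cdot> w0 = Zero C X D" using hx[OF w0] pw0 qw0 fu by simp
    then obtain w where w: "w \<in> Hom C X K" "k \<cdot> w = w0"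
      using kernel_factor[OF kk h w0] dk by auto
    show "\<exists>!w. w \<in> Hom C X K \<and> (p \<cdot> k) \<cdot> w = u \<and> (q \<cdot> k) \<cdot> w = v"
    proof (rule ex1I[of _ w], intro conjI)
      show "w \<in> Hom C X K" by (fact w(1))
      show "(p \<cdot> k) \<cdot> w = u" using Comp_assoc[OF w(1) k(1) b(3)] w(2) pw0 by simp
      show "(q \<cdot> k) \<cdot> w = v" using Comp_assoc[OF w(1) k(1) b(4)] w(2) qw0 by simp
      fix w' assume w': "w' \<in> Hom C X K \<and> (p \<cdot> k) \<cdot> w' = u \<and> (q \<cdot> k) \<cdot> w' = v"
      then have w'X: "w' \<in> Hom C X K" by simp
      note kw' = Comp_in_Hom[OF w'X k(1)]
      have "k \<cdot> w' = Add C (i \<cdot> p) (j \<cdot> q) \<cdot> (k \<cdot> w')" using b(9) Id_Comp[OF kw'] by simp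
      also have "\<dots> = w0"
        unfolding w0_def
        using Add_Comp[OF kw' Comp_in_Hom[OF b(3,1)] Comp_in_Hom[OF b(4,2)]]
          Comp_assoc[OF kw' b(3,1)] Comp_assoc[OF kw' b(4,2)]
          Comp_assoc[OF w'X k(1) b(3)] Comp_assoc[OF w'X k(1) b(4)] w' by simp
      finally show "w' = w" using kernel_mono[OF kk] w'X w dk by metis
    qed
  qed simp
  then show ?thesis by (rule that)
qed

text \<open>
  The existence of the canonical decomposition: \<open>f\<close> kills \<open>ker f\<close> and so factors through \<open>coim f\<close>,
  and the resulting factor is killed by \<open>coker f\<close> because \<open>coim f\<close> is epic.
\<close>

lemma coim_bar:
  assumes "f \<in> Hom C A B"
  shows "coim C f \<in> Hom C A (Coim_obj C f)" "epi (coim C f)"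
    and "strict_epi_arr C (coim C f)"
    and "bar C f \<in> Hom C (Coim_obj C f) (Im_obj C f)" "f = im C f \<cdot> (bar C f \<cdot> coim C f)"
proof -
  note k = ker_Hom[OF assms] and c = coker_Hom[OF assms] and m = im_Hom[OF assms]
  have ce: "is_cokernel C (ker C f) (coim C f)"
    unfolding coim_def by (rule is_cokernel_coker[OF k(1)])
  show e: "coim C f \<in> Hom C A (Coim_obj C f)"
    using cokernelD(1)[OF ce k(1)] by (simp add: Coim_obj_def)
  show ee: "epi (coim C f)" by (rule epi_cokernel[OF ce])
  show "strict_epi_arr C (coim C f)" using ce by (auto simp: strict_epi_arr_def)
  obtain f' where f': "f' \<in> Hom C (Coim_obj C f) B" "f' \<cdot> coim C f = f"
    using cokernel_factor[OF ce k(1) assms k(2)] by (auto simp: Coim_obj_def)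
  note cf' = Comp_in_Hom[OF f'(1) c(1)]
  have "coker C f \<cdot> f' = Zero C (Coim_obj C f) (Coker_obj C f)"
    using epiD[OF ee e cf'] Comp_assoc[OF e f'(1) c(1)] f'(2) c(2) by simp
  then obtain b where b: "b \<in> Hom C (Coim_obj C f) (Im_obj C f)" "im C f \<cdot> b = f'"
    using im_factor[OF assms f'(1)] by blast
  have fb: "f = im C f \<cdot> (b \<cdot> coim C f)" using Comp_assoc[OF e b(1) m(1)] b(2) f'(2) by simp
  have "b' = b" if b': "b' \<in> Hom C (Coim_obj C f) (Im_obj C f)"
    "f = im C f \<cdot> (b' \<cdot> coim C f)" for b'
  proof -
    have "b' \<cdot> coim C f = b \<cdot> coim C f"
      using kernel_mono[OF is_kernel_im[OF assms], folded Im_obj_def,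
          OF Comp_in_Hom[OF e b'(1)] Comp_in_Hom[OF e b(1)]] b'(2) fb by simp
    then show ?thesis by (rule epi_eq[OF ee e b'(1) b(1)])
  qed
  then have "\<exists>!b. b \<in> Hom C (Coim_obj C f) (Im_obj C f) \<and> f = im C f \<cdot> (b \<cdot> coim C f)"
    using b(1) fb by blast
  from theI'[OF this]
  show "bar C f \<in> Hom C (Coim_obj C f) (Im_obj C f)" "f = im C f \<cdot> (bar C f \<cdot> coim C f)"
    unfolding bar_def by auto
qed

text \<open>
  Generalised elements lift along strict morphisms, at the cost of refining the domain by an
  epimorphism. When \<open>f\<close> is strict, an element of its image becomes an element of \<open>Coim f\<close>, and the
  pullback of the strict epimorphism \<open>coim f\<close> along that element is again an epimorphism.
\<close>

lemma strict_lift: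
  assumes "strict C f" "f \<in> Hom C A B" "x \<in> Hom C X B"
    and "coker C f \<cdot> x = Zero C X (Coker_obj C f)"
  obtains Y p y where "p \<in> Hom C Y X" "epi p" "y \<in> Hom C Y A" "f \<cdot> y = x \<cdot> p"
proof -
  note e = coim_bar[OF assms(2)] and m = im_Hom[OF assms(2)]
  obtain u where u: "u \<in> Hom C X (Im_obj C f)" "im C f \<cdot> u = x"
    using im_factor[OF assms(2-4)] .
  obtain b' where b': "b' \<in> Hom C (Im_obj C f) (Coim_obj C f)"
    "bar C f \<cdot> b' = Id C (Im_obj C f)"
    using assms(1) e(4) unfolding strict_def is_iso_def by (auto simp: Hom_def)
  note bu = Comp_in_Hom[OF u(1) b'(1)]
  obtain y p where pb: "is_pullback C (coim C f) (b' \<cdot> u) y p"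
    using ex_pullback[OF e(1) bu] .
  have "strict_epi_arr C p" by (rule strict_epi_pullback[OF pb e(3)])
  then have p: "epi p" using epi_cokernel by (auto simp: strict_epi_arr_def)
  have yp: "y \<in> Hom C (Dom C y) A" "p \<in> Hom C (Dom C y) X"
    and eq: "coim C f \<cdot> y = (b' \<cdot> u) \<cdot> p"
    using pb unfolding is_pullback_def Hom_arr[OF e(1)] Hom_arr[OF bu] by auto
  have "f \<cdot> y = im C f \<cdot> (bar C f \<cdot> (coim C f \<cdot> y))"
    using e(5) Comp_assoc[OF yp(1) Comp_in_Hom[OF e(1,4)] m(1)] Comp_assoc[OF yp(1) e(1,4)] by simp
  also have "bar C f \<cdot> (coim C f \<cdot> y) = u \<cdot> p"
  proof -
    have "bar C f \<cdot> ((b' \<cdot> u) \<cdot> p) = (bar C f \<cdot> (b' \<cdot> u)) \<cdot> p"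
      using Comp_assoc[OF yp(2) bu e(4)] by simp
    also have "bar C f \<cdot> (b' \<cdot> u) = u"
      using Comp_assoc[OF u(1) b'(1) e(4)] b'(2) Id_Comp[OF u(1)] by simp
    finally show ?thesis using eq by simp
  qed
  also have "im C f \<cdot> (u \<cdot> p) = x \<cdot> p" using Comp_assoc[OF yp(2) u(1) m(1)] u(2) by simp
  finally show ?thesis using that yp p by blast
qed


section \<open>Vanishing of the Lambek invariants\<close>

text \<open>
  When \<open>Im S = 0\<close>, the image of the diagonal is the intersection of the images of \<open>f\<close> and \<open>\<beta>\<close>.
  The vanishing makes \<open>\<rho>\<close> epic. The inclusion \<open>n\<close> of the intersection satisfies
  \<open>n \<cdot> \<rho> = im (f \<cdot> \<alpha>)\<close>, so \<open>coker (f \<cdot> \<alpha>) \<cdot> n\<close> becomes zero after composing with \<open>\<rho>\<close>, and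
  therefore is zero.
\<close>

lemma square_Im_zero:
  assumes "is_zero_object C (square_Im C \<alpha> g \<beta> f)"
    and \<alpha>: "\<alpha> \<in> Hom C X D" and g: "g \<in> Hom C X A" and \<beta>: "\<beta> \<in> Hom C A B" and f: "f \<in> Hom C D B"
    and comm: "f \<cdot> \<alpha> = \<beta> \<cdot> g"
    and x: "x \<in> Hom C Y B"
    and fx: "coker C f \<cdot> x = Zero C Y (Coker_obj C f)"
    and \<beta>x: "coker C \<beta> \<cdot> x = Zero C Y (Coker_obj C \<beta>)"
  shows "coker C (f \<cdot> \<alpha>) \<cdot> x = Zero C Y (Coker_obj C (f \<cdot> \<alpha>))"
proof -
  define d where "d = f \<cdot> \<alpha>"
  have d: "d \<in> Hom C X B" unfolding d_def by (rule Comp_in_Hom[OF \<alpha> f])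
  note mf = im_Hom[OF f] and m\<beta> = im_Hom[OF \<beta>] and md = im_Hom[OF d]
  note cf = coker_Hom[OF f] and c\<beta> = coker_Hom[OF \<beta>] and cd = coker_Hom[OF d]
  have kill_im: "h \<cdot> im C d = Zero C (Im_obj C d) E"
    if h: "h \<in> Hom C B E" "h \<cdot> d = Zero C X E" for h E
  proof -
    obtain h' where h': "h' \<in> Hom C (Coker_obj C d) E" "h' \<cdot> coker C d = h"
      using cokernel_factor[OF is_cokernel_coker[OF d] d h] by (auto simp: Coker_obj_def)
    show ?thesis using Comp_eq_Zero_right[OF md(1) cd(1) h'(1) md(2)] h'(2) by simp
  qed
  have "coker C f \<cdot> d = Zero C X (Coker_obj C f)"
    unfolding d_def by (rule Comp_eq_Zero_left[OF \<alpha> f cf])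
  then obtain k' where k': "k' \<in> Hom C (Im_obj C d) (Im_obj C f)" "im C f \<cdot> k' = im C d"
    using im_factor[OF f md(1)] kill_im[OF cf(1)] by blast
  have "coker C \<beta> \<cdot> d = Zero C X (Coker_obj C \<beta>)"
    unfolding d_def comm by (rule Comp_eq_Zero_left[OF g \<beta> c\<beta>])
  then obtain l' where l': "l' \<in> Hom C (Im_obj C d) (Im_obj C \<beta>)" "im C \<beta> \<cdot> l' = im C d"
    using im_factor[OF \<beta> md(1)] kill_im[OF c\<beta>(1)] by blast
  have fk: "factor_through C (im C f) (im C d) = k'"
    by (rule factor_through_eq[OF is_kernel_im[OF f] mf(1) k'])
  have fl: "factor_through C (im C \<beta>) (im C d) = l'"
    by (rule factor_through_eq[OF is_kernel_im[OF \<beta>] m\<beta>(1) l'])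
  obtain k l where kl: "pullback_proj C (im C f) (im C \<beta>) = (k, l)" by fastforce
  have "\<exists>z. case z of (k, l) \<Rightarrow> is_pullback C (im C f) (im C \<beta>) k l"
    by (rule ex_pullback[OF mf(1) m\<beta>(1)]) auto
  from someI_ex[OF this] have pb: "is_pullback C (im C f) (im C \<beta>) k l"
    using kl by (simp add: pullback_proj_def)
  have k: "k \<in> Hom C (Dom C k) (Im_obj C f)"
    and univ: "\<And>Z u v. u \<in> Hom C Z (Im_obj C f) \<Longrightarrow> v \<in> Hom C Z (Im_obj C \<beta>) \<Longrightarrow>
      im C f \<cdot> u = im C \<beta> \<cdot> v \<Longrightarrow> \<exists>!w. w \<in> Hom C Z (Dom C k) \<and> k \<cdot> w = u \<and> l \<cdot> w = v"
    using pb unfolding is_pullback_def Hom_arr[OF mf(1)] Hom_arr[OF m\<beta>(1)] by auto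
  define \<rho> where "\<rho> = square_rho C \<alpha> g \<beta> f"
  have "\<rho> = (THE \<rho>. \<rho> \<in> Hom C (Im_obj C d) (Dom C k) \<and> k \<cdot> \<rho> = k' \<and> l \<cdot> \<rho> = l')"
    unfolding \<rho>_def square_rho_def d_def[symmetric] kl fk fl by simp
  then have \<rho>: "\<rho> \<in> Hom C (Im_obj C d) (Dom C k)" "k \<cdot> \<rho> = k'"
    using theI'[OF univ[OF k'(1) l'(1)]] k'(2) l'(2) by auto
  have ep: "epi \<rho>"
    using epi_if_zero_cokernel[OF is_cokernel_coker[OF \<rho>(1)]] assms(1)
    by (simp add: square_Im_def Coker_obj_def \<rho>_def)
  define n where "n = im C f \<cdot> k"
  have n: "n \<in> Hom C (Dom C k) B" unfolding n_def by (rule Comp_in_Hom[OF k mf(1)])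
  have "n \<cdot> \<rho> = im C d" unfolding n_def using Comp_assoc[OF \<rho>(1) k mf(1)] \<rho>(2) k'(2) by simp
  then have cn: "coker C d \<cdot> n = Zero C (Dom C k) (Coker_obj C d)"
    using epiD[OF ep \<rho>(1) Comp_in_Hom[OF n cd(1)]] Comp_assoc[OF \<rho>(1) n cd(1)] md(2) by simp
  obtain u where u: "u \<in> Hom C Y (Im_obj C f)" "im C f \<cdot> u = x" using im_factor[OF f x fx] .
  obtain v where v: "v \<in> Hom C Y (Im_obj C \<beta>)" "im C \<beta> \<cdot> v = x" using im_factor[OF \<beta> x \<beta>x] .
  obtain w where w: "w \<in> Hom C Y (Dom C k)" "k \<cdot> w = u"
    using univ[OF u(1) v(1)] u(2) v(2) by auto
  have "n \<cdot> w = x" unfolding n_def using Comp_assoc[OF w(1) k mf(1)] w(2) u(2) by simp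
  then show ?thesis using Comp_eq_Zero_left[OF w(1) n cd(1) cn] by (simp add: d_def)
qed

text \<open>
  When \<open>Ker S = 0\<close>, the morphism from \<open>Ker g \<oplus> Ker \<alpha>\<close> to the kernel of the diagonal is epic, so a
  morphism that kills both summands kills the whole kernel of the diagonal.
\<close>

lemma square_Ker_zero:
  assumes "is_zero_object C (square_Ker C \<alpha> g \<beta> f)"
    and \<alpha>: "\<alpha> \<in> Hom C X D" and g: "g \<in> Hom C X A" and \<beta>: "\<beta> \<in> Hom C A B" and f: "f \<in> Hom C D B"
    and comm: "f \<cdot> \<alpha> = \<beta> \<cdot> g"
    and h: "h \<in> Hom C X E"
    and hg: "h \<cdot> ker C g = Zero C (Ker_obj C g) E"
    and h\<alpha>: "h \<cdot> ker C \<alpha> = Zero C (Ker_obj C \<alpha>) E"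
    and z: "z \<in> Hom C Y X" and dz: "(f \<cdot> \<alpha>) \<cdot> z = Zero C Y B"
  shows "h \<cdot> z = Zero C Y E"
proof -
  define d where "d = f \<cdot> \<alpha>"
  have d: "d \<in> Hom C X B" unfolding d_def by (rule Comp_in_Hom[OF \<alpha> f])
  note kd = ker_Hom[OF d] and kg = ker_Hom[OF g] and k\<alpha> = ker_Hom[OF \<alpha>]
  note kdk = is_kernel_ker[OF d]
  have "d \<cdot> ker C g = Zero C (Ker_obj C g) B"
    unfolding d_def comm by (rule Comp_eq_Zero_right[OF kg(1) g \<beta> kg(2)])
  then obtain \<mu> where \<mu>: "\<mu> \<in> Hom C (Ker_obj C g) (Ker_obj C d)" "ker C d \<cdot> \<mu> = ker C g"
    using kernel_factor[OF kdk d kg(1)] by (auto simp: Ker_obj_def)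
  have "d \<cdot> ker C \<alpha> = Zero C (Ker_obj C \<alpha>) B"
    unfolding d_def by (rule Comp_eq_Zero_right[OF k\<alpha>(1) \<alpha> f k\<alpha>(2)])
  then obtain \<nu> where \<nu>: "\<nu> \<in> Hom C (Ker_obj C \<alpha>) (Ker_obj C d)" "ker C d \<cdot> \<nu> = ker C \<alpha>"
    using kernel_factor[OF kdk d k\<alpha>(1)] by (auto simp: Ker_obj_def)
  have f\<mu>: "factor_through C (ker C d) (ker C g) = \<mu>"
    by (rule factor_through_eq[OF kdk kd(1) \<mu>])
  have f\<nu>: "factor_through C (ker C d) (ker C \<alpha>) = \<nu>"
    by (rule factor_through_eq[OF kdk kd(1) \<nu>])
  define s where "s = copair C \<mu> \<nu>"
  obtain i j P where ij: "i \<in> Hom C (Ker_obj C g) P" "j \<in> Hom C (Ker_obj C \<alpha>) P"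
    and s: "s \<in> Hom C P (Ker_obj C d)" "s \<cdot> i = \<mu>" "s \<cdot> j = \<nu>"
    and joint: "\<And>Y h. h \<in> Hom C P Y \<Longrightarrow> h \<cdot> i = Zero C (Ker_obj C g) Y \<Longrightarrow>
      h \<cdot> j = Zero C (Ker_obj C \<alpha>) Y \<Longrightarrow> h = Zero C P Y"
    using copair[OF \<mu>(1) \<nu>(1)] unfolding s_def by metis
  have ep: "epi s"
    using epi_if_zero_cokernel[OF is_cokernel_coker[OF s(1)]] assms(1)
    by (simp add: square_Ker_def Coker_obj_def s_def d_def[symmetric] f\<mu> f\<nu>)
  define t where "t = h \<cdot> ker C d"
  have t: "t \<in> Hom C (Ker_obj C d) E" unfolding t_def by (rule Comp_in_Hom[OF kd(1) h])
  have "(t \<cdot> s) \<cdot> i = Zero C (Ker_obj C g) E"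
    using Comp_assoc[OF ij(1) s(1) t] s(2) Comp_assoc[OF \<mu>(1) kd(1) h] \<mu>(2) hg by (simp add: t_def)
  moreover have "(t \<cdot> s) \<cdot> j = Zero C (Ker_obj C \<alpha>) E"
    using Comp_assoc[OF ij(2) s(1) t] s(3) Comp_assoc[OF \<nu>(1) kd(1) h] \<nu>(2) h\<alpha> by (simp add: t_def)
  ultimately have "t \<cdot> s = Zero C P E" by (rule joint[OF Comp_in_Hom[OF s(1) t]])
  then have t0: "h \<cdot> ker C d = Zero C (Ker_obj C d) E"
    using epiD[OF ep s(1) t] by (simp add: t_def)
  obtain w where w: "w \<in> Hom C Y (Ker_obj C d)" "ker C d \<cdot> w = z"
    using kernel_factor[OF kdk d z] dz by (auto simp: Ker_obj_def d_def)
  show ?thesis using Comp_eq_Zero_left[OF w(1) kd(1) h t0] w(2) by simp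
qed

end


section \<open>Exactness of the middle column\<close>

theorem theorem4:
  fixes \<A> :: "('o, 'm, 'x) preadditive_scheme"
  assumes quasi_abelian: "quasi_abelian_category \<A>"
    and row1: "\<theta>\<^sub>1 \<in> Hom \<A> A\<^sub>1 B\<^sub>1" "\<theta>\<^sub>2 \<in> Hom \<A> B\<^sub>1 C\<^sub>1"
    and row2: "\<phi>\<^sub>1 \<in> Hom \<A> A\<^sub>2 B\<^sub>2" "\<phi>\<^sub>2 \<in> Hom \<A> B\<^sub>2 C\<^sub>2"
    and row3: "\<psi>\<^sub>1 \<in> Hom \<A> A\<^sub>3 B\<^sub>3" "\<psi>\<^sub>2 \<in> Hom \<A> B\<^sub>3 C\<^sub>3"
    and col1: "\<alpha>\<^sub>1 \<in> Hom \<A> A\<^sub>1 A\<^sub>2" "\<alpha>\<^sub>2 \<in> Hom \<A> A\<^sub>2 A\<^sub>3"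
    and col2: "\<beta>\<^sub>1 \<in> Hom \<A> B\<^sub>1 B\<^sub>2" "\<beta>\<^sub>2 \<in> Hom \<A> B\<^sub>2 B\<^sub>3"
    and col3: "\<gamma>\<^sub>1 \<in> Hom \<A> C\<^sub>1 C\<^sub>2" "\<gamma>\<^sub>2 \<in> Hom \<A> C\<^sub>2 C\<^sub>3"
    and S_commutes: "\<beta>\<^sub>1 \<cdot>\<^bsub>\<A>\<^esub> \<theta>\<^sub>1 = \<phi>\<^sub>1 \<cdot>\<^bsub>\<A>\<^esub> \<alpha>\<^sub>1"
    and T_commutes: "\<gamma>\<^sub>1 \<cdot>\<^bsub>\<A>\<^esub> \<theta>\<^sub>2 = \<phi>\<^sub>2 \<cdot>\<^bsub>\<A>\<^esub> \<beta>\<^sub>1"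
    and U_commutes: "\<beta>\<^sub>2 \<cdot>\<^bsub>\<A>\<^esub> \<phi>\<^sub>1 = \<psi>\<^sub>1 \<cdot>\<^bsub>\<A>\<^esub> \<alpha>\<^sub>2"
    and V_commutes: "\<gamma>\<^sub>2 \<cdot>\<^bsub>\<A>\<^esub> \<phi>\<^sub>2 = \<psi>\<^sub>2 \<cdot>\<^bsub>\<A>\<^esub> \<beta>\<^sub>2"
    and col1_exact: "exact \<A> \<alpha>\<^sub>1 \<alpha>\<^sub>2"
    and col3_exact: "exact \<A> \<gamma>\<^sub>1 \<gamma>\<^sub>2"
    and row2_exact: "exact \<A> \<phi>\<^sub>1 \<phi>\<^sub>2"
    and Im_T: "is_zero_object \<A> (square_Im \<A> \<theta>\<^sub>2 \<beta>\<^sub>1 \<phi>\<^sub>2 \<gamma>\<^sub>1)"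
    and Ker_U: "is_zero_object \<A> (square_Ker \<A> \<phi>\<^sub>1 \<alpha>\<^sub>2 \<psi>\<^sub>1 \<beta>\<^sub>2)"
    and col2_zero: "\<beta>\<^sub>2 \<cdot>\<^bsub>\<A>\<^esub> \<beta>\<^sub>1 = Zero \<A> B\<^sub>1 B\<^sub>3"
    and strict_\<phi>\<^sub>1: "strict \<A> \<phi>\<^sub>1"
    and strict_\<phi>\<^sub>2_\<beta>\<^sub>1: "strict \<A> (\<phi>\<^sub>2 \<cdot>\<^bsub>\<A>\<^esub> \<beta>\<^sub>1)"
  shows "exact \<A> \<beta>\<^sub>1 \<beta>\<^sub>2"
proof -
  interpret quasi_abelian_category \<A> by (rule quasi_abelian)
  define c where "c = coker \<A> \<beta>\<^sub>1"
  define Q where "Q = Coker_obj \<A> \<beta>\<^sub>1"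
  define x where "x = ker \<A> \<beta>\<^sub>2"
  define K where "K = Ker_obj \<A> \<beta>\<^sub>2"
  have c: "c \<in> Hom \<A> B\<^sub>2 Q" "c \<cdot>\<^bsub>\<A>\<^esub> \<beta>\<^sub>1 = Zero \<A> B\<^sub>1 Q"
    using coker_Hom[OF col2(1)] by (simp_all add: c_def Q_def)
  have x: "x \<in> Hom \<A> K B\<^sub>2" "\<beta>\<^sub>2 \<cdot>\<^bsub>\<A>\<^esub> x = Zero \<A> K B\<^sub>3"
    using ker_Hom[OF col2(2)] by (simp_all add: x_def K_def)
  note \<phi>x = Comp_in_Hom[OF x(1) row2(2)]

  have "\<gamma>\<^sub>2 \<cdot>\<^bsub>\<A>\<^esub> (\<phi>\<^sub>2 \<cdot>\<^bsub>\<A>\<^esub> x) = Zero \<A> K C\<^sub>3"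
    using Comp_assoc[OF x(1) row2(2) col3(2)] V_commutes
      Comp_eq_Zero_right[OF x(1) col2(2) row3(2) x(2)] by simp
  then have in_\<gamma>: "coker \<A> \<gamma>\<^sub>1 \<cdot>\<^bsub>\<A>\<^esub> (\<phi>\<^sub>2 \<cdot>\<^bsub>\<A>\<^esub> x) = Zero \<A> K (Coker_obj \<A> \<gamma>\<^sub>1)"
    by (rule exact_coker_Comp[OF col3_exact col3 \<phi>x])
  have in_\<phi>: "coker \<A> \<phi>\<^sub>2 \<cdot>\<^bsub>\<A>\<^esub> (\<phi>\<^sub>2 \<cdot>\<^bsub>\<A>\<^esub> x) = Zero \<A> K (Coker_obj \<A> \<phi>\<^sub>2)"
    by (rule Comp_eq_Zero_left[OF x(1) row2(2) coker_Hom[OF row2(2)]])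
  have in_d: "coker \<A> (\<phi>\<^sub>2 \<cdot>\<^bsub>\<A>\<^esub> \<beta>\<^sub>1) \<cdot>\<^bsub>\<A>\<^esub> (\<phi>\<^sub>2 \<cdot>\<^bsub>\<A>\<^esub> x)
      = Zero \<A> K (Coker_obj \<A> (\<phi>\<^sub>2 \<cdot>\<^bsub>\<A>\<^esub> \<beta>\<^sub>1))"
    using square_Im_zero[OF Im_T row1(2) col2(1) row2(2) col3(1) T_commutes \<phi>x in_\<gamma> in_\<phi>]
    by (simp add: T_commutes)
  obtain L p y where p: "p \<in> Hom \<A> L K" "epi p" and y: "y \<in> Hom \<A> L B\<^sub>1"
    and py: "(\<phi>\<^sub>2 \<cdot>\<^bsub>\<A>\<^esub> \<beta>\<^sub>1) \<cdot>\<^bsub>\<A>\<^esub> y = (\<phi>\<^sub>2 \<cdot>\<^bsub>\<A>\<^esub> x) \<cdot>\<^bsub>\<A>\<^esub> p"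
    using strict_lift[OF strict_\<phi>\<^sub>2_\<beta>\<^sub>1 Comp_in_Hom[OF col2(1) row2(2)] \<phi>x in_d] .

  \<comment> \<open>With \<open>y'\<close> as the negative of \<open>y\<close>, the sum \<open>d\<close> below is the difference \<open>x \<cdot> p - \<beta>\<^sub>1 \<cdot> y\<close>.\<close>
  obtain y' where y': "y' \<in> Hom \<A> L B\<^sub>1" "Add \<A> y y' = Zero \<A> L B\<^sub>1"
    using obtain_negative[OF y] .
  note xp = Comp_in_Hom[OF p(1) x(1)] and \<beta>y' = Comp_in_Hom[OF y'(1) col2(1)]
  define d where "d = Add \<A> (x \<cdot>\<^bsub>\<A>\<^esub> p) (\<beta>\<^sub>1 \<cdot>\<^bsub>\<A>\<^esub> y')"
  have d: "d \<in> Hom \<A> L B\<^sub>2" unfolding d_def by (rule Add_in_Hom[OF xp \<beta>y'])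
  note \<phi>\<beta> = Comp_in_Hom[OF col2(1) row2(2)]
  have L: "L \<in> Obj \<A>" using Hom_obj[OF y] by simp
  have "\<phi>\<^sub>2 \<cdot>\<^bsub>\<A>\<^esub> d = Add \<A> ((\<phi>\<^sub>2 \<cdot>\<^bsub>\<A>\<^esub> \<beta>\<^sub>1) \<cdot>\<^bsub>\<A>\<^esub> y) ((\<phi>\<^sub>2 \<cdot>\<^bsub>\<A>\<^esub> \<beta>\<^sub>1) \<cdot>\<^bsub>\<A>\<^esub> y')"
    unfolding d_def py using Comp_Add[OF xp \<beta>y' row2(2)] Comp_assoc[OF p(1) x(1) row2(2)]
      Comp_assoc[OF y'(1) col2(1) row2(2)] by simp
  also have "\<dots> = Zero \<A> L C\<^sub>2"
    using Comp_Add[OF y y'(1) \<phi>\<beta>] y'(2) Comp_Zero[OF \<phi>\<beta> L] by simp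
  finally have \<phi>d: "\<phi>\<^sub>2 \<cdot>\<^bsub>\<A>\<^esub> d = Zero \<A> L C\<^sub>2" .
  have cd: "c \<cdot>\<^bsub>\<A>\<^esub> d = c \<cdot>\<^bsub>\<A>\<^esub> (x \<cdot>\<^bsub>\<A>\<^esub> p)"
    unfolding d_def using Comp_Add[OF xp \<beta>y' c(1)] Comp_eq_Zero_left[OF y'(1) col2(1) c]
      Add_Zero[OF Comp_in_Hom[OF xp c(1)]] by simp
  have \<beta>d: "\<beta>\<^sub>2 \<cdot>\<^bsub>\<A>\<^esub> d = Zero \<A> L B\<^sub>3"
    unfolding d_def using Comp_Add[OF xp \<beta>y' col2(2)] Comp_eq_Zero_left[OF p(1) x(1) col2(2) x(2)]
      Comp_eq_Zero_left[OF y'(1) col2 col2_zero]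
      Add_Zero[OF Zero_in_Hom[OF L Hom_obj(2)[OF col2(2)]]] by simp
  obtain M q z where q: "q \<in> Hom \<A> M L" "epi q" and z: "z \<in> Hom \<A> M A\<^sub>2"
    and qz: "\<phi>\<^sub>1 \<cdot>\<^bsub>\<A>\<^esub> z = d \<cdot>\<^bsub>\<A>\<^esub> q"
    using strict_lift[OF strict_\<phi>\<^sub>1 row2(1) d exact_coker_Comp[OF row2_exact row2 d \<phi>d]] .

  note c\<phi> = Comp_in_Hom[OF row2(1) c(1)]
  note k\<alpha> = ker_Hom[OF col1(2)] and k\<phi> = ker_Hom[OF row2(1)]
  have "(c \<cdot>\<^bsub>\<A>\<^esub> \<phi>\<^sub>1) \<cdot>\<^bsub>\<A>\<^esub> \<alpha>\<^sub>1 = Zero \<A> A\<^sub>1 Q"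
    using Comp_assoc[OF col1(1) row2(1) c(1)] S_commutes Comp_eq_Zero_left[OF row1(1) col2(1) c]
    by simp
  then obtain r where r: "r \<in> Hom \<A> (Coker_obj \<A> \<alpha>\<^sub>1) Q" "r \<cdot>\<^bsub>\<A>\<^esub> coker \<A> \<alpha>\<^sub>1 = c \<cdot>\<^bsub>\<A>\<^esub> \<phi>\<^sub>1"
    using cokernel_factor[OF is_cokernel_coker[OF col1(1)] col1(1) c\<phi>] by (auto simp: Coker_obj_def)
  have h\<alpha>: "(c \<cdot>\<^bsub>\<A>\<^esub> \<phi>\<^sub>1) \<cdot>\<^bsub>\<A>\<^esub> ker \<A> \<alpha>\<^sub>2 = Zero \<A> (Ker_obj \<A> \<alpha>\<^sub>2) Q"
    using Comp_eq_Zero_right[OF k\<alpha>(1) coker_Hom(1)[OF col1(1)] r(1)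
        exact_coker_Comp[OF col1_exact col1 k\<alpha>]] r(2) by simp
  have h\<phi>: "(c \<cdot>\<^bsub>\<A>\<^esub> \<phi>\<^sub>1) \<cdot>\<^bsub>\<A>\<^esub> ker \<A> \<phi>\<^sub>1 = Zero \<A> (Ker_obj \<A> \<phi>\<^sub>1) Q"
    by (rule Comp_eq_Zero_right[OF k\<phi>(1) row2(1) c(1) k\<phi>(2)])
  have "(\<beta>\<^sub>2 \<cdot>\<^bsub>\<A>\<^esub> \<phi>\<^sub>1) \<cdot>\<^bsub>\<A>\<^esub> z = Zero \<A> M B\<^sub>3"
    using Comp_assoc[OF z row2(1) col2(2)] qz Comp_eq_Zero_left[OF q(1) d col2(2) \<beta>d] by simp
  then have "(c \<cdot>\<^bsub>\<A>\<^esub> \<phi>\<^sub>1) \<cdot>\<^bsub>\<A>\<^esub> z = Zero \<A> M Q"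
    by (rule square_Ker_zero[OF Ker_U row2(1) col1(2) row3(1) col2(2) U_commutes c\<phi> h\<alpha> h\<phi> z])
  then have "(c \<cdot>\<^bsub>\<A>\<^esub> d) \<cdot>\<^bsub>\<A>\<^esub> q = Zero \<A> M Q"
    using Comp_assoc[OF z row2(1) c(1)] Comp_assoc[OF q(1) d c(1)] qz by simp
  then have "c \<cdot>\<^bsub>\<A>\<^esub> d = Zero \<A> L Q" by (rule epiD[OF q(2,1) Comp_in_Hom[OF d c(1)]])
  then have "(c \<cdot>\<^bsub>\<A>\<^esub> x) \<cdot>\<^bsub>\<A>\<^esub> p = Zero \<A> L Q" using cd Comp_assoc[OF p(1) x(1) c(1)] by simp
  then have "c \<cdot>\<^bsub>\<A>\<^esub> x = Zero \<A> K Q" by (rule epiD[OF p(2,1) Comp_in_Hom[OF x(1) c(1)]])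
  then show ?thesis
    using exactI[OF col2 col2_zero] by (simp add: c_def x_def K_def Q_def)
qed

end
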